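(* (i) There is an infinity of optimal quadratic polynomials for $p_0=2$: $$Q_1(x)=x^2+(p_1-3)x+2,$$ where $p_1$ is prime. If $|p_1-6|$ is prime, then $Q_1(x)$ is bi-optimal. (ii) There are at least three quadratic polynomials for $p_0=13$, $$Q_3(x)=x^2+27x+13,\qquad Q_4(x)=x^2-3x+13,\qquad Q_5(x)=2x^2-4x+13,$$ that form 12-plets, one prime value short of optimal (prime values at $x=0,1,\ldots,11$, but not at $x=12$). Hence $$Q_3(x-1)=x^2+25x-13$$ is optimal. The polynomial $Q_5(-x)$ forms a decuplet, making $Q_5(x)$ almost bi-optimal. There is another polynomial, $$Q_6(x)=2x^2+26x+13,$$ that forms a decuplet.
   Context: Let $P(x)=\sum_{j=0}^n a_jx^j$ be a non-constant polynomial with integer coefficients such that $|a_0|=p_0$ is a prime number. $P$ is called optimal (for $p_0$) if $|P(j)|$ is prime for $j=0,1,\ldots,p_0-1$ (forming a $p_0$-plet), and bi-optimal if $|P(j)|$ is prime for all integers $j$ with $1-p_0\le j\le p_0-1$ (forming a $(2p_0-1)$-plet). The prime values may repeat, and values of $P$ may be negative. $P$ forms an $N$-plet if $|P(j)|$ is prime for $j=0,1,\ldots,N-1$; a decuplet is a 10-plet. "Almost bi-optimal" is an informal term: $|P(j)|$ is prime for all but a few of the integers $j$ with $1-p_0\le j\le p_0-1$. *)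

theory Defs
  imports "HOL-Computational_Algebra.Polynomial" "HOL-Computational_Algebra.Primes"
begin

definition prime_const_poly :: "nat \<Rightarrow> int poly \<Rightarrow> bool" where
  "prime_const_poly p0 P \<longleftrightarrow> degree P > 0 \<and> prime p0 \<and> \<bar>coeff P 0\<bar> = int p0"

text \<open>
  Values of \<open>P\<close> may be negative and may repeat; an \<open>N\<close>-plet may extend beyond \<open>N\<close> terms.
\<close>
definition forms_plet :: "nat \<Rightarrow> int poly \<Rightarrow> bool" where
  "forms_plet N P \<longleftrightarrow> (\<forall>j<N. prime \<bar>poly P (int j)\<bar>)"

definition optimal :: "nat \<Rightarrow> int poly \<Rightarrow> bool" where
  "optimal p0 P \<longleftrightarrow> prime_const_poly p0 P \<and> forms_plet p0 P"

definition bi_optimal :: "nat \<Rightarrow> int poly \<Rightarrow> bool" where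
  "bi_optimal p0 P \<longleftrightarrow> prime_const_poly p0 P \<and>
     (\<forall>j\<in>{1 - int p0..int p0 - 1}. prime \<bar>poly P j\<bar>)"

text \<open>
  ``Almost bi-optimal'' is informal (all but a few values are prime); it is made precise by
  naming the set \<open>E\<close> of exactly those arguments at which primality fails.
  The case \<open>E = {}\<close> is bi-optimality.
\<close>
definition bi_optimal_except :: "int set \<Rightarrow> nat \<Rightarrow> int poly \<Rightarrow> bool" where
  "bi_optimal_except E p0 P \<longleftrightarrow> prime_const_poly p0 P \<and>
     {j \<in> {1 - int p0..int p0 - 1}. \<not> prime \<bar>poly P j\<bar>} = E"

text \<open>Coefficients are listed from the constant term upwards.\<close>

definition Q1 :: "nat \<Rightarrow> int poly" where "Q1 p1 = [:2, int p1 - 3, 1:]"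
definition Q3 :: "int poly" where "Q3 = [:13, 27, 1:]"
definition Q4 :: "int poly" where "Q4 = [:13, -3, 1:]"
definition Q5 :: "int poly" where "Q5 = [:13, -4, 2:]"
definition Q6 :: "int poly" where "Q6 = [:13, 26, 2:]"

end

theory Submission
  imports Defs
begin

text \<open>For \<open>p0 = 2\<close> only the arguments -1, 0, 1 matter, and there
  \<open>Q1 p\<close> takes the values 6 - p, 2, p; so primality of p gives optimality
  (\<open>optimal_Q1\<close>) and primality of |p - 6| gives the rest
  (\<open>bi_optimal_Q1\<close>). Infinitude is Euclid's theorem carried along the injective map
  \<open>Q1\<close>. For \<open>p0 = 13\<close> every claim is a finite computation: quantifying
  over the list \<open>[0..<N]\<close> instead of a bound lets the simplifier unfold the range and
  test each value.\<close>

lemma forms_plet_iff_upt: "forms_plet N P \<longleftrightarrow> (\<forall>j\<in>set [0..<N]. prime \<bar>poly P (int j)\<bar>)"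
  by (auto simp: forms_plet_def)

lemma degree_Q:
  "degree (Q1 p) = 2" "degree Q3 = 2" "degree Q4 = 2" "degree Q5 = 2" "degree Q6 = 2"
  by (simp_all add: Q1_def Q3_def Q4_def Q5_def Q6_def)

text \<open>The linear coefficient p - 3 determines p, so distinct primes give distinct
  polynomials.\<close>

lemma inj_Q1: "inj Q1"
  by (auto simp: inj_def Q1_def)

lemma optimal_Q1:
  assumes "prime p"
  shows "optimal 2 (Q1 p)"
  using assms
  by (auto simp: optimal_def prime_const_poly_def forms_plet_def Q1_def less_2_cases_iff)

lemma bi_optimal_Q1:
  assumes "prime p" and "prime \<bar>int p - 6\<bar>"
  shows "bi_optimal 2 (Q1 p)"
proof -
  have "{1 - int 2..int 2 - 1} = {-1, 0, 1}" by auto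
  \<comment> \<open>The value at -1 is 6 - p, the negative of the number assumed prime in absolute
    value.\<close>
  moreover have "\<bar>6 - int p\<bar> = \<bar>int p - 6\<bar>" by simp
  ultimately show ?thesis
    using assms by (simp add: bi_optimal_def prime_const_poly_def Q1_def)
qed

lemma infinite_optimal_Q1:
  "infinite {P. degree P = 2 \<and> optimal 2 P \<and> (\<exists>p::nat. prime p \<and> P = Q1 p)}"
proof -
  have "infinite (Q1 ` {p. prime p})"
    using primes_infinite inj_on_subset[OF inj_Q1] by (simp add: finite_image_iff)
  moreover have "Q1 ` {p. prime p} \<subseteq>
      {P. degree P = 2 \<and> optimal 2 P \<and> (\<exists>p::nat. prime p \<and> P = Q1 p)}"
    by (auto simp: degree_Q optimal_Q1)
  ultimately show ?thesis
    by (rule infinite_super[rotated])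
qed

lemma prime_13: "prime (13::nat)"
  by simp

lemma prime_const_poly_Q:
  "prime_const_poly 13 Q3" "prime_const_poly 13 Q4" "prime_const_poly 13 Q5" "prime_const_poly 13 Q6"
  unfolding prime_const_poly_def degree_Q
  using prime_13 by (simp_all add: Q3_def Q4_def Q5_def Q6_def)

lemma plet_Q3: "forms_plet 12 Q3"
  by (simp add: forms_plet_iff_upt Q3_def upt_rec)

lemma plet_Q4: "forms_plet 12 Q4"
  by (simp add: forms_plet_iff_upt Q4_def upt_rec)

lemma plet_Q5: "forms_plet 12 Q5"
  by (simp add: forms_plet_iff_upt Q5_def upt_rec)

lemma plet_Q6: "forms_plet 10 Q6"
  by (simp add: forms_plet_iff_upt Q6_def upt_rec)

text \<open>Checked by evaluation. The length 10 also follows from Q5(x) = 2(x-1)^2 + 11: by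
  symmetry Q5(-j) = Q5(j+2), so the arguments 2,...,11 of the 12-plet reflect to 0,...,-9.\<close>

lemma plet_reflected_Q5: "forms_plet 10 (pcompose Q5 [:0, -1:])"
  by (simp add: forms_plet_iff_upt Q5_def upt_rec poly_pcompose)

text \<open>The values are 481 = 13*37, 121 = 11^2 and 253 = 11*23.\<close>

lemma not_prime_at_12:
  "\<not> prime \<bar>poly Q3 12\<bar>" "\<not> prime \<bar>poly Q4 12\<bar>" "\<not> prime \<bar>poly Q5 12\<bar>"
  by (simp_all add: Q3_def Q4_def Q5_def)

lemma shifted_Q3: "pcompose Q3 [:-1, 1:] = [:-13, 25, 1:]"
  by (simp add: Q3_def pcompose_pCons)

text \<open>The shift drops the composite value at 12 and prepends Q3(-1) = -13, prime in absolute
  value, which is also the new constant term.\<close>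

lemma optimal_shifted_Q3: "optimal 13 (pcompose Q3 [:-1, 1:])"
  using prime_13
  by (simp add: optimal_def prime_const_poly_def shifted_Q3 forms_plet_iff_upt upt_rec)

lemma bi_optimal_except_Q5: "bi_optimal_except {-11, -10, 12} 13 Q5"
proof -
  \<comment> \<open>As a filter over an explicit list, the exceptional set can be computed. The
    failures are Q5(-11) = 299 = 13*23 and Q5(-10) = Q5(12) = 253 = 11*23; Q5(-12) = 349 is
    prime.\<close>
  have "{j \<in> {1 - int 13..int 13 - 1}. \<not> prime \<bar>poly Q5 j\<bar>} =
      set (filter (\<lambda>j. \<not> prime \<bar>poly Q5 j\<bar>) [1 - int 13..int 13 - 1])"
    by (simp only: set_filter set_upto)
  also have "[1 - int 13..int 13 - 1] = [-12,-11,-10,-9,-8,-7,-6,-5,-4,-3,-2,-1,0,1,2,3,4,5,6,7,8,9,10,11,12]"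
    by (simp add: upto_rec1 del: set_upto)
  also have "set (filter (\<lambda>j. \<not> prime \<bar>poly Q5 j\<bar>) \<dots>) = {-11, -10, 12}"
    by (simp add: Q5_def)
  finally show ?thesis
    by (simp add: bi_optimal_except_def prime_const_poly_Q)
qed

lemma distinct_Q: "distinct [Q3, Q4, Q5]" "Q6 \<notin> {Q3, Q4, Q5}"
  by (simp_all add: Q3_def Q4_def Q5_def Q6_def)

theorem proposition4p4:
  shows
    "infinite {P. degree P = 2 \<and> optimal 2 P \<and> (\<exists>p1::nat. prime p1 \<and> P = Q1 p1)} \<and>
     (\<forall>p1::nat. prime p1 \<longrightarrow> degree (Q1 p1) = 2 \<and> optimal 2 (Q1 p1)) \<and>
     (\<forall>p1::nat. prime p1 \<and> prime \<bar>int p1 - 6\<bar> \<longrightarrow> bi_optimal 2 (Q1 p1)) \<and>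
     distinct [Q3, Q4, Q5] \<and>
     (\<forall>P\<in>{Q3, Q4, Q5}. degree P = 2 \<and> prime_const_poly 13 P \<and>
        forms_plet 12 P \<and> \<not> prime \<bar>poly P 12\<bar>) \<and>
     pcompose Q3 [:-1, 1:] = [:-13, 25, 1:] \<and>
     optimal 13 (pcompose Q3 [:-1, 1:]) \<and>
     forms_plet 10 (pcompose Q5 [:0, -1:]) \<and>
     bi_optimal_except {-11, -10, 12} 13 Q5 \<and>
     Q6 \<notin> {Q3, Q4, Q5} \<and> degree Q6 = 2 \<and> prime_const_poly 13 Q6 \<and> forms_plet 10 Q6"
  using infinite_optimal_Q1 optimal_Q1 bi_optimal_Q1 plet_Q3 plet_Q4 plet_Q5 plet_Q6
    plet_reflected_Q5 not_prime_at_12 shifted_Q3 optimal_shifted_Q3 bi_optimal_except_Q5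
    prime_const_poly_Q degree_Q distinct_Q
  by simp

end
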